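(* Let $\beta_1,\beta_2,\dots$ be an admissible enumeration of $\mathbb{Q}/\mathbb{Z}$. Then $\{(f_{\beta_n},\mathcal{B}_n):n=1,2,\dots\}$ is a sequence of martingale differences on $\mathbb{R}/\mathbb{Z}$ with normalized Haar measure. That is: - each $f_{\beta_n}$ is $\mathcal{B}_n$-measurable; - $\mathcal{B}_1\subseteq\mathcal{B}_2\subseteq\cdots$; - for every $n\ge1$ the conditional expectation of $f_{\beta_{n+1}}$ given $\mathcal{B}_n$ is $0$ almost everywhere. Equivalently, $\int_Jf_{\beta_{n+1}}(x)\,dx=0$ for every connected component $J$ of $\mathbb{R}/\mathbb{Z}\setminus\{\beta_1,\dots,\beta_n\}$.
   Context: Every $\beta\in\mathbb{Q}/\mathbb{Z}$ can be written $\beta=a/q$ with $q\ge1$ and $\gcd(a,q)=1$; its height is $h(\beta)=q$. Put $\mathcal{F}_Q=\{\beta:h(\beta)\le Q\}$. For distinct $a,b\in\mathbb{R}/\mathbb{Z}$, $I(a,b)$ is the open arc from $a$ to $b$ in the positive direction, i.e. $\{a+t\bmod1:0<t<d\}$ with $d\in(0,1)$, $d\equiv b-a\pmod1$. For $\beta\ne0$ with $h(\beta)=Q$: $\beta'$ is the unique point of $\mathcal{F}_Q$ with $I(\beta',\beta)\cap\mathcal{F}_Q=\emptyset$, and $\beta''$ is the unique point of $\mathcal{F}_Q$ with $I(\beta,\beta'')\cap\mathcal{F}_Q=\emptyset$. Let $\psi(x)=x-[x]-\frac12$ for $x\notin\mathbb{Z}$ and $\psi(x)=0$ for $x\in\mathbb{Z}$.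 Define $f_0\equiv1$ and, for $\beta\ne0$, $f_\beta(x)=h(\beta)\psi(x-\beta)-h(\beta')\psi(x-\beta')-h(\beta'')\psi(x-\beta'')$. An enumeration (a bijection $n\mapsto\beta_n$ from the positive integers onto $\mathbb{Q}/\mathbb{Z}$) is admissible if all three of the following hold: (i) $\beta_1=0$; (ii) whenever $m\ge2$ and $\beta_k=\beta_m'$, we have $k<m$; (iii) whenever $m\ge2$ and $\beta_l=\beta_m''$, we have $l<m$. $\mathcal{B}_n$ is the $\sigma$-algebra generated by the connected components of $\mathbb{R}/\mathbb{Z}\setminus\{\beta_1,\dots,\beta_n\}$ together with the singletons $\{\beta_1\},\dots,\{\beta_n\}$. *)

theory Defs
  imports "HOL-Probability.Probability"
begin

section \<open>The circle group \<open>\<real>/\<int>\<close>\<close>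

quotient_type circle = real / "\<lambda>x y. x - y \<in> \<int>"
proof (rule equivpI)
  show "reflp (\<lambda>x y::real. x - y \<in> \<int>)"
    by (simp add: reflp_def)
  show "symp (\<lambda>x y::real. x - y \<in> \<int>)"
    by (auto simp: symp_def dest: Ints_minus)
  show "transp (\<lambda>x y::real. x - y \<in> \<int>)"
    unfolding transp_def using Ints_add by fastforce
qed

lift_definition to_circle :: "real \<Rightarrow> circle" is "\<lambda>x. x" .

instantiation circle :: ab_group_add
begin

lift_definition zero_circle :: circle is 0 .

lift_definition plus_circle :: "circle \<Rightarrow> circle \<Rightarrow> circle" is "(+)"
  by (simp only: add_diff_add Ints_add)

lift_definition uminus_circle :: "circle \<Rightarrow> circle" is uminus
  using Ints_minus by fastforce

lift_definition minus_circle :: "circle \<Rightarrow> circle \<Rightarrow> circle" is "(-)"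
proof -
  fix a b c d :: real
  assume "a - b \<in> \<int>" "c - d \<in> \<int>"
  then have "(a - b) - (c - d) \<in> \<int>" by (rule Ints_diff)
  then show "a - c - (b - d) \<in> \<int>" by (simp add: algebra_simps)
qed

instance
  by standard (transfer; simp)+

end

instantiation circle :: topological_space
begin

text \<open>The quotient topology.\<close>

definition open_circle :: "circle set \<Rightarrow> bool" where
  "open_circle U \<longleftrightarrow> open (to_circle -` U)"

instance
  by standard (auto simp: open_circle_def vimage_Union)

end

lemma to_circle_eq_iff: "to_circle x = to_circle y \<longleftrightarrow> x - y \<in> \<int>"
  by transfer simp

lemma to_circle_add: "to_circle (x + y) = to_circle x + to_circle y"
  by transfer simp

lemma to_circle_surj: "\<exists>x. c = to_circle x"
proof transfer
  fix c :: real
  show "\<exists>x. c - x \<in> \<int>" by (rule exI[of _ c]) simp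
qed

lemma continuous_to_circle: "continuous_on UNIV to_circle"
  by (simp add: continuous_on_open_vimage open_circle_def)

lemma measurable_to_circle [measurable]: "to_circle \<in> borel_measurable borel"
  by (rule borel_measurable_continuous_onI[OF continuous_to_circle])

text \<open>Normalized Haar measure, as the image of Lebesgue measure on a fundamental domain; the
  two lemmas below are the properties that characterize it.\<close>

definition haar :: "circle measure" where
  "haar = distr (restrict_space lborel {0..<1}) borel to_circle"

lemma prob_space_haar: "prob_space haar"
proof -
  have "prob_space (restrict_space lborel {0..<1::real})"
    by (rule prob_spaceI) (simp add: emeasure_restrict_space space_restrict_space)
  moreover have "to_circle \<in> measurable (restrict_space lborel {0..<1}) borel"
    by (intro measurable_restrict_space1) simp
  ultimately show ?thesis
    unfolding haar_def by (rule prob_space.prob_space_distr)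
qed

lemma emeasure_haar:
  assumes "A \<in> sets borel"
  shows "emeasure haar A = emeasure lborel (to_circle -` A \<inter> {0..<1})"
proof -
  have [measurable]: "to_circle -` A \<in> sets borel"
    using measurable_sets[OF measurable_to_circle assms] by simp
  show ?thesis
    unfolding haar_def using assms
    by (subst emeasure_distr)
       (auto simp: emeasure_restrict_space space_restrict_space intro!: measurable_restrict_space1)
qed

lemma haar_translation_invariant: "distr haar borel (\<lambda>x. c + x) = haar"
proof (rule measure_eqI)
  show "sets (distr haar borel (\<lambda>x. c + x)) = sets haar"
    by (simp add: haar_def)
next
  fix A assume "A \<in> sets (distr haar borel (\<lambda>x. c + x))"
  then have A: "A \<in> sets borel" by simp
  obtain s0 where s0: "c = to_circle s0" using to_circle_surj by blast
  define s where "s = frac s0"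
  have s: "0 \<le> s" "s < 1" by (auto simp: s_def frac_lt_1)
  have cs: "c = to_circle s"
    unfolding s0 s_def to_circle_eq_iff by (simp add: frac_def)
  have shift_open: "open ((\<lambda>x. c + x) -` U)" if "open U" for U :: "circle set"
  proof -
    have "to_circle -` ((\<lambda>x. c + x) -` U) = (\<lambda>x. s + x) -` (to_circle -` U)"
      by (auto simp: cs to_circle_add)
    moreover have "open ((\<lambda>x. s + x) -` (to_circle -` U))"
      using that unfolding open_circle_def by (rule open_vimage) (intro continuous_intros)
    ultimately show ?thesis by (simp add: open_circle_def)
  qed
  have meas: "(\<lambda>x. c + x) \<in> measurable borel borel"
    by (rule borel_measurableI) (simp add: shift_open)
  have measc: "(\<lambda>x. c + x) -` A \<in> sets borel"
    using measurable_sets[OF meas A] by simp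
  let ?B = "to_circle -` A"
  have B [measurable]: "?B \<in> sets borel"
    using measurable_sets[OF measurable_to_circle A] by simp
  have per: "x + 1 \<in> ?B \<longleftrightarrow> x \<in> ?B" for x
  proof -
    have "to_circle (x + 1) = to_circle x" by (simp add: to_circle_eq_iff)
    then show ?thesis by simp
  qed
  have tr: "emeasure lborel X = emeasure lborel ((\<lambda>x. t + x) -` X)" if "X \<in> sets borel" for X and t :: real
  proof -
    have "emeasure lborel X = emeasure (distr lborel borel ((+) t)) X"
      by (simp add: lborel_distr_plus)
    also have "\<dots> = emeasure lborel ((\<lambda>x. t + x) -` X)"
      using that by (subst emeasure_distr) auto
    finally show ?thesis .
  qed
  have sp: "space haar = UNIV" "sets haar = sets borel"
    by (auto simp: haar_def)
  have "emeasure (distr haar borel (\<lambda>x. c + x)) A = emeasure haar ((\<lambda>x. c + x) -` A)"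
    using A meas sp by (subst emeasure_distr) (auto simp: measurable_def)
  also have "\<dots> = emeasure lborel (to_circle -` ((\<lambda>x. c + x) -` A) \<inter> {0..<1})"
    by (rule emeasure_haar[OF measc])
  also have "to_circle -` ((\<lambda>x. c + x) -` A) \<inter> {0..<1} = (\<lambda>x. s + x) -` (?B \<inter> {s..<1+s})"
    by (auto simp: cs to_circle_add)
  also have "emeasure lborel \<dots> = emeasure lborel (?B \<inter> {s..<1+s})"
    by (rule tr[symmetric]) simp
  also have "?B \<inter> {s..<1+s} = (?B \<inter> {s..<1}) \<union> (?B \<inter> {1..<1+s})"
    using s by auto
  also have "emeasure lborel \<dots> = emeasure lborel (?B \<inter> {s..<1}) + emeasure lborel (?B \<inter> {1..<1+s})"
    by (intro plus_emeasure[symmetric]) auto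
  also have "emeasure lborel (?B \<inter> {1..<1+s}) = emeasure lborel ((\<lambda>x. 1 + x) -` (?B \<inter> {1..<1+s}))"
    by (rule tr) simp
  also have "(\<lambda>x. 1 + x) -` (?B \<inter> {1..<1+s}) = ?B \<inter> {0..<s}"
    using per by (auto simp: add.commute)
  also have "emeasure lborel (?B \<inter> {s..<1}) + emeasure lborel (?B \<inter> {0..<s})
      = emeasure lborel ((?B \<inter> {s..<1}) \<union> (?B \<inter> {0..<s}))"
    by (intro plus_emeasure) auto
  also have "(?B \<inter> {s..<1}) \<union> (?B \<inter> {0..<s}) = ?B \<inter> {0..<1}"
    using s by auto
  also have "emeasure lborel \<dots> = emeasure haar A"
    by (rule emeasure_haar[OF A, symmetric])
  finally show "emeasure (distr haar borel (\<lambda>x. c + x)) A = emeasure haar A" .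
qed


section \<open>Farey points and the functions \<open>f\<^sub>\<beta>\<close>\<close>

definition rat_circle :: "circle set" where
  "rat_circle = to_circle ` \<rat>"

text \<open>Meaningful only for \<open>\<beta> \<in> rat_circle\<close>.\<close>

definition height :: "circle \<Rightarrow> nat" where
  "height \<beta> = (THE q. q \<ge> 1 \<and>
     (\<exists>a::int. coprime a (int q) \<and> \<beta> = to_circle (of_int a / of_nat q)))"

definition farey :: "nat \<Rightarrow> circle set" where
  "farey Q = {\<beta> \<in> rat_circle. height \<beta> \<le> Q}"

text \<open>Meaningful only for \<open>a \<noteq> b\<close>; for \<open>a = b\<close> the set is empty, which is why distinctness is
  required explicitly in the definitions of the two neighbours below.\<close>

definition arc_between :: "circle \<Rightarrow> circle \<Rightarrow> circle set" where
  "arc_between a b =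
     {a + to_circle t | t d. 0 < d \<and> d < 1 \<and> to_circle d = b - a \<and> 0 < t \<and> t < d}"

definition left_nbr :: "circle \<Rightarrow> circle" where
  "left_nbr \<beta> = (THE \<gamma>. \<gamma> \<in> farey (height \<beta>) \<and> \<gamma> \<noteq> \<beta> \<and>
     arc_between \<gamma> \<beta> \<inter> farey (height \<beta>) = {})"

definition right_nbr :: "circle \<Rightarrow> circle" where
  "right_nbr \<beta> = (THE \<gamma>. \<gamma> \<in> farey (height \<beta>) \<and> \<gamma> \<noteq> \<beta> \<and>
     arc_between \<beta> \<gamma> \<inter> farey (height \<beta>) = {})"

lift_definition psi :: "circle \<Rightarrow> real" is
  "\<lambda>x. if x \<in> \<int> then 0 else x - of_int \<lfloor>x\<rfloor> - 1/2"
proof -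
  fix x y :: real
  assume "x - y \<in> \<int>"
  then obtain k where "x - y = of_int k" by (elim Ints_cases)
  then have x: "x = y + of_int k" by simp
  have "x \<in> \<int> \<longleftrightarrow> y \<in> \<int>"
    unfolding x by (metis Ints_add Ints_diff Ints_of_int add_diff_cancel_right')
  then show "(if x \<in> \<int> then 0 else x - of_int \<lfloor>x\<rfloor> - 1/2) =
      (if y \<in> \<int> then 0 else y - of_int \<lfloor>y\<rfloor> - 1/2)"
    by (simp add: x)
qed

definition farey_fun :: "circle \<Rightarrow> circle \<Rightarrow> real" where
  "farey_fun \<beta> x =
     (if \<beta> = 0 then 1
      else real (height \<beta>) * psi (x - \<beta>)
         - real (height (left_nbr \<beta>)) * psi (x - left_nbr \<beta>)
         - real (height (right_nbr \<beta>)) * psi (x - right_nbr \<beta>))"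


section \<open>Admissible enumerations and the associated filtration\<close>

text \<open>Enumerations are indexed by the positive integers; the value at \<open>0\<close> is irrelevant.\<close>

definition admissible :: "(nat \<Rightarrow> circle) \<Rightarrow> bool" where
  "admissible \<beta> \<longleftrightarrow>
     bij_betw \<beta> {1..} rat_circle \<and>
     \<beta> 1 = 0 \<and>
     (\<forall>m k. m \<ge> 2 \<and> k \<ge> 1 \<and> \<beta> k = left_nbr (\<beta> m) \<longrightarrow> k < m) \<and>
     (\<forall>m l. m \<ge> 2 \<and> l \<ge> 1 \<and> \<beta> l = right_nbr (\<beta> m) \<longrightarrow> l < m)"

definition filt :: "(nat \<Rightarrow> circle) \<Rightarrow> nat \<Rightarrow> circle measure" where
  "filt \<beta> n = sigma UNIV
     (components (UNIV - \<beta> ` {1..n}) \<union> {{\<beta> k} | k. k \<in> {1..n}})"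

end

theory Submission
  imports Defs
begin

text \<open>
  Write \<open>\<beta> \<noteq> 0\<close> as the mediant of its two Farey neighbours \<open>\<beta>' = p1/q1\<close> and \<open>\<beta>'' = p2/q2\<close>. Since
  numerators and denominators add, \<open>f\<^sub>\<beta>\<close> is, away from \<open>\<beta>'\<close>, \<open>\<beta>\<close>, \<open>\<beta>''\<close>, the step function with value
  \<open>q1\<close> on the arc from \<open>\<beta>'\<close> to \<open>\<beta>\<close> (of length \<open>1/(q1 (q1 + q2))\<close>), \<open>-q2\<close> on the arc from \<open>\<beta>\<close> to
  \<open>\<beta>''\<close> (of length \<open>1/(q2 (q1 + q2))\<close>), and \<open>0\<close> elsewhere; so its integral over the arc from \<open>\<beta>'\<close>
  to \<open>\<beta>''\<close> vanishes. In an admissible enumeration every rational point of that arc other than \<open>\<beta>\<close>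
  comes after \<open>\<beta>\<close>. Hence just before \<open>\<beta>\<close> is added, every set of the \<open>\<sigma>\<close>-algebra either contains
  this arc or misses it, and the integral of \<open>f\<^sub>\<beta>\<close> over the set is \<open>0\<close>.
\<close>

section \<open>Real representatives, topology and arcs of the circle\<close>

lemma to_circle_0: "to_circle 0 = 0"
  by transfer simp

lemma to_circle_diff: "to_circle (x - y) = to_circle x - to_circle y"
  by transfer simp

text \<open>The window \<open>[s, s + 1)\<close> is left free so that it can start at an end of the
  arc under study, where no wrap-around occurs.\<close>

lemma to_circle_rep: "\<exists>x. c = to_circle x \<and> s \<le> x \<and> x < s + 1"
proof -
  obtain y where y: "c = to_circle y" using to_circle_surj by blast
  have "c = to_circle (s + frac (y - s))"
    unfolding y to_circle_eq_iff by (simp add: frac_def)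
  then show ?thesis
    by (intro exI[of _ "s + frac (y - s)"]) (simp add: frac_lt_1)
qed

text \<open>Turns equalities on the circle into equalities of reals: an integer of absolute value
  below 1 is 0.\<close>

lemma to_circle_eq_close:
  assumes "to_circle x = to_circle y" "\<bar>x - y\<bar> < 1"
  shows "x = y"
proof -
  from assms(1) obtain k where k: "x - y = of_int k"
    by (auto simp: to_circle_eq_iff elim: Ints_cases)
  with assms(2) have "\<bar>of_int k :: real\<bar> < 1" by simp
  then have "k = 0" by linarith
  with k show ?thesis by simp
qed

text \<open>The saturation of \<open>S\<close> is the union of its integer translates, each of which
  is open.\<close>

lemma open_to_circle_image:
  assumes "open S"
  shows "open (to_circle ` S)"
proof -
  have "to_circle -` (to_circle ` S) = (\<Union>k::int. (+) (of_int k) ` S)"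
  proof (intro set_eqI iffI)
    fix x assume "x \<in> to_circle -` (to_circle ` S)"
    then obtain y where "y \<in> S" "x - y \<in> \<int>" by (auto simp: to_circle_eq_iff)
    then obtain k where "x = of_int k + y" by (metis Ints_cases diff_add_cancel)
    with \<open>y \<in> S\<close> show "x \<in> (\<Union>k::int. (+) (of_int k) ` S)" by auto
  next
    fix x assume "x \<in> (\<Union>k::int. (+) (of_int k) ` S)"
    then obtain k :: int and y where "y \<in> S" "x = of_int k + y" by auto
    then have "to_circle x = to_circle y" by (simp add: to_circle_eq_iff)
    with \<open>y \<in> S\<close> show "x \<in> to_circle -` (to_circle ` S)" by auto
  qed
  then show ?thesis
    using assms by (simp add: open_circle_def open_translation open_UN)
qed

lemma connected_to_circle_image:
  assumes "connected S"
  shows "connected (to_circle ` S)"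
  using continuous_on_subset[OF continuous_to_circle] assms
  by (rule connected_continuous_image) simp

lemma closed_circle_singleton: "closed {c :: circle}"
proof -
  obtain x where x: "c = to_circle x" using to_circle_surj by blast
  have "- {c} = to_circle ` {x<..<x + 1}"
  proof (intro set_eqI iffI)
    fix d assume d: "d \<in> - {c}"
    obtain y where y: "d = to_circle y" "x \<le> y" "y < x + 1" using to_circle_rep by blast
    with d x have "y \<noteq> x" by auto
    with y show "d \<in> to_circle ` {x<..<x + 1}" by auto
  next
    fix d assume "d \<in> to_circle ` {x<..<x + 1}"
    then show "d \<in> - {c}" using to_circle_eq_close[of _ x] x by fastforce
  qed
  then show ?thesis by (simp add: closed_def open_to_circle_image)
qed

lemma arc_between_to_circle:
  assumes "a < b" "b < a + 1"
  shows "arc_between (to_circle a) (to_circle b) = to_circle ` {a<..<b}"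
proof (intro set_eqI iffI)
  fix c assume "c \<in> arc_between (to_circle a) (to_circle b)"
  then obtain t d where td: "c = to_circle a + to_circle t" "0 < d" "d < 1"
    "to_circle d = to_circle b - to_circle a" "0 < t" "t < d"
    unfolding arc_between_def by blast
  then have "to_circle d = to_circle (b - a)" by (simp add: to_circle_diff)
  then have "d = b - a" by (rule to_circle_eq_close) (use assms td in linarith)
  with td show "c \<in> to_circle ` {a<..<b}"
    by (intro image_eqI[of _ _ "a + t"]) (auto simp: to_circle_add)
next
  fix c assume "c \<in> to_circle ` {a<..<b}"
  then obtain x where x: "c = to_circle x" "a < x" "x < b" by auto
  have "c = to_circle a + to_circle (x - a)" by (simp add: x to_circle_diff)
  moreover have "to_circle (b - a) = to_circle b - to_circle a" by (rule to_circle_diff)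
  ultimately show "c \<in> arc_between (to_circle a) (to_circle b)"
    unfolding arc_between_def using x assms
    by (intro CollectI exI[of _ "x - a"] exI[of _ "b - a"]) auto
qed

text \<open>The two points cut the circle into two disjoint open arcs, and a connected set avoiding
  both points meets at most one of them. For \<open>b = a + 1\<close> the second arc is
  empty.\<close>

lemma connected_arc_dichotomy:
  assumes "a < b" "b \<le> a + 1" "connected J" "to_circle a \<notin> J" "to_circle b \<notin> J"
  shows "J \<subseteq> to_circle ` {a<..<b} \<or> J \<inter> to_circle ` {a<..<b} = {}"
proof -
  let ?A = "to_circle ` {a<..<b}" and ?B = "to_circle ` {b<..<a + 1}"
  have disj: "?A \<inter> ?B = {}"
  proof (rule ccontr)
    assume "?A \<inter> ?B \<noteq> {}"
    then obtain x y where "a < x" "x < b" "b < y" "y < a + 1" "to_circle x = to_circle y" by auto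
    then show False using to_circle_eq_close[of x y] by auto
  qed
  have cover: "J \<subseteq> ?A \<union> ?B"
  proof
    fix c assume c: "c \<in> J"
    obtain x where "c = to_circle x" "a \<le> x" "x < a + 1" using to_circle_rep by blast
    moreover from this c assms(4,5) have "x \<noteq> a" "x \<noteq> b" by auto
    ultimately show "c \<in> ?A \<union> ?B" by (cases "x < b") auto
  qed
  have "?A \<inter> J = {} \<or> ?B \<inter> J = {}"
    by (rule connectedD[OF assms(3)]) (use disj cover in \<open>auto intro: open_to_circle_image\<close>)
  with cover show ?thesis by blast
qed

text \<open>Supplies the uniqueness needed for \<open>THE\<close> in \<open>left_nbr\<close>: of two
  distinct candidates, the one nearer to \<open>b\<close> would lie in the arc that the other one
  requires to be free of \<open>F\<close>.\<close>

lemma left_gap_unique: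
  assumes "\<gamma> \<in> F" "\<gamma> \<noteq> b" "arc_between \<gamma> b \<inter> F = {}"
    and "\<delta> \<in> F" "\<delta> \<noteq> b" "arc_between \<delta> b \<inter> F = {}"
  shows "\<gamma> = \<delta>"
proof -
  obtain z where z: "b = to_circle z" using to_circle_surj by blast
  have rep: "\<exists>x. c = to_circle x \<and> z - 1 < x \<and> x < z" if "c \<noteq> b" for c
  proof -
    obtain x where x: "c = to_circle x" "z - 1 \<le> x" "x < z - 1 + 1" using to_circle_rep by blast
    have "x \<noteq> z - 1" using that x z by (auto simp: to_circle_eq_iff)
    with x show ?thesis by (intro exI[of _ x]) auto
  qed
  obtain x where x: "\<gamma> = to_circle x" "z - 1 < x" "x < z" using rep assms(2) by blast
  obtain y where y: "\<delta> = to_circle y" "z - 1 < y" "y < z" using rep assms(5) by blast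
  have "\<not> x < y"
    using arc_between_to_circle[of x z] assms(3,4) x y z by (fastforce simp: disjoint_iff)
  moreover have "\<not> y < x"
    using arc_between_to_circle[of y z] assms(1,6) x y z by (fastforce simp: disjoint_iff)
  ultimately show ?thesis using x y by simp
qed

lemma right_gap_unique:
  assumes "\<gamma> \<in> F" "\<gamma> \<noteq> b" "arc_between b \<gamma> \<inter> F = {}"
    and "\<delta> \<in> F" "\<delta> \<noteq> b" "arc_between b \<delta> \<inter> F = {}"
  shows "\<gamma> = \<delta>"
proof -
  obtain z where z: "b = to_circle z" using to_circle_surj by blast
  have rep: "\<exists>x. c = to_circle x \<and> z < x \<and> x < z + 1" if "c \<noteq> b" for c
  proof -
    obtain x where x: "c = to_circle x" "z \<le> x" "x < z + 1" using to_circle_rep by blast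
    have "x \<noteq> z" using that x z by auto
    with x show ?thesis by (intro exI[of _ x]) auto
  qed
  obtain x where x: "\<gamma> = to_circle x" "z < x" "x < z + 1" using rep assms(2) by blast
  obtain y where y: "\<delta> = to_circle y" "z < y" "y < z + 1" using rep assms(5) by blast
  have "\<not> y < x"
    using arc_between_to_circle[of z x] assms(3,4) x y z by (fastforce simp: disjoint_iff)
  moreover have "\<not> x < y"
    using arc_between_to_circle[of z y] assms(1,6) x y z by (fastforce simp: disjoint_iff)
  ultimately show ?thesis using x y by simp
qed

section \<open>Haar measure of arcs and values of the sawtooth function\<close>

lemma sets_haar: "sets haar = sets borel"
  by (simp add: haar_def)

lemma space_haar: "space haar = UNIV"
  by (simp add: haar_def)

lemma arc_sets: "to_circle ` {u<..<v} \<in> sets haar"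
  unfolding sets_haar by (intro borel_open open_to_circle_image) simp

lemma measure_haar_arc:
  assumes "0 \<le> a" "a \<le> b" "b \<le> 1"
  shows "measure haar (to_circle ` {a<..<b}) = b - a"
proof -
  \<comment> \<open>The bounds keep the interval inside the fundamental domain, so no other integer
    translate of it meets \<open>[0, 1)\<close>.\<close>
  have "to_circle -` to_circle ` {a<..<b} \<inter> {0..<1} = {a<..<b}"
    using assms to_circle_eq_close by (fastforce simp: image_iff)
  moreover have "to_circle ` {a<..<b} \<in> sets borel"
    by (intro borel_open open_to_circle_image) simp
  ultimately show ?thesis
    using assms by (simp add: measure_def emeasure_haar)
qed

lemma haar_singleton: "{c} \<in> null_sets haar"
proof -
  obtain x where x: "c = to_circle x" "0 \<le> x" "x < 0 + 1" using to_circle_rep by blast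
  then have "to_circle -` {c} \<inter> {0..<1} = {x}"
    using to_circle_eq_close[of _ x] by auto
  moreover have "{c} \<in> sets borel"
    by (intro borel_closed closed_circle_singleton)
  ultimately show ?thesis
    by (auto simp: null_sets_def sets_haar emeasure_haar)
qed

lemma psi_to_circle_pos:
  assumes "0 < t" "t < 1"
  shows "psi (to_circle t) = t - 1/2"
proof -
  have "\<lfloor>t\<rfloor> = 0" using assms by linarith
  moreover have "t \<notin> \<int>" using assms by (auto elim!: Ints_cases)
  ultimately show ?thesis by transfer auto
qed

lemma psi_to_circle_neg:
  assumes "-1 < t" "t < 0"
  shows "psi (to_circle t) = t + 1/2"
proof -
  have "to_circle t = to_circle (t + 1)" by (simp add: to_circle_eq_iff)
  with psi_to_circle_pos[of "t + 1"] assms show ?thesis by simp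
qed

section \<open>Reduced fractions and heights\<close>

text \<open>After clearing denominators, \<open>q\<close> divides \<open>a * r\<close> and
  \<open>r\<close> divides \<open>b * q\<close>; by coprimality each denominator divides the other.
  This makes \<open>height\<close> well defined.\<close>

lemma height_unique:
  fixes a b :: int and q r :: nat
  assumes "q \<ge> 1" "coprime a (int q)" "r \<ge> 1" "coprime b (int r)"
    and "to_circle (of_int a / of_nat q) = to_circle (of_int b / of_nat r)"
  shows "q = r"
proof -
  obtain k :: int where k: "of_int a / of_nat q - of_int b / of_nat r = (of_int k :: real)"
    using assms(5) by (auto simp: to_circle_eq_iff elim: Ints_cases)
  have "real_of_int (a * int r - b * int q) = of_int (k * int q * int r)"
    using k assms(1,3) by (simp add: field_simps)
  then have eq: "a * int r - b * int q = k * int q * int r" by (simp only: of_int_eq_iff)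
  have "a * int r = int q * (b + k * int r)" using eq by (simp add: algebra_simps)
  then have "int q dvd a * int r" by simp
  then have 1: "int q dvd int r" using assms(2)
    by (simp add: coprime_commute coprime_dvd_mult_right_iff)
  have "b * int q = int r * (a - k * int q)" using eq by (simp add: algebra_simps)
  then have "int r dvd b * int q" by simp
  then have "int r dvd int q" using assms(4)
    by (simp add: coprime_commute coprime_dvd_mult_right_iff)
  with 1 show ?thesis by (simp add: dvd_antisym)
qed

lemma height_eq:
  fixes a q :: int
  assumes "q > 0" "coprime a q"
  shows "height (to_circle (of_int a / of_int q)) = nat q"
  unfolding height_def
proof (rule the_equality)
  show "nat q \<ge> 1 \<and> (\<exists>b. coprime b (int (nat q)) \<and>
      to_circle (of_int a / of_int q) = to_circle (of_int b / of_nat (nat q)))"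
    using assms by (auto intro!: exI[of _ a])
next
  fix r assume "r \<ge> 1 \<and> (\<exists>b. coprime b (int r) \<and>
      to_circle (of_int a / of_int q) = to_circle (of_int b / of_nat r))"
  then show "r = nat q" using height_unique[of "nat q" a r] assms by fastforce
qed

lemma rat_circle_to_circleD:
  assumes "to_circle x \<in> rat_circle"
  shows "\<exists>a q::int. q > 0 \<and> coprime a q \<and> x = of_int a / of_int q"
proof -
  obtain y where "y \<in> \<rat>" "to_circle x = to_circle y"
    using assms by (auto simp: rat_circle_def)
  then have "x - y \<in> \<rat>" "y \<in> \<rat>" by (auto simp: to_circle_eq_iff elim!: Ints_cases)
  then have "x \<in> \<rat>" by (metis Rats_add diff_add_cancel)
  then show ?thesis by (metis Rats_cases')
qed

lemma to_circle_in_rat_circle: "to_circle (of_int a / of_int q) \<in> rat_circle"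
  by (simp add: rat_circle_def)

lemma rat_circle_rep:
  assumes "c \<in> rat_circle" "c \<noteq> 0"
  shows "\<exists>a q::int. 0 < a \<and> a < q \<and> coprime a q \<and> c = to_circle (of_int a / of_int q)"
proof -
  obtain x where x: "c = to_circle x" "0 \<le> x" "x < 0 + 1" using to_circle_rep by blast
  with assms to_circle_0 have "x \<noteq> 0" by auto
  obtain a q :: int where "q > 0" "coprime a q" "x = of_int a / of_int q"
    using rat_circle_to_circleD assms(1) x(1) by blast
  with x \<open>x \<noteq> 0\<close> show ?thesis
    by (intro exI[of _ a] exI[of _ q]) (auto simp: field_simps zero_less_divide_iff)
qed

section \<open>Mediants of adjacent Farey fractions\<close>

text \<open>
  Adjacent fractions \<open>p1/q1 < p2/q2\<close> in \<open>[0, 1]\<close>. The mediant \<open>m\<close> plays the role of \<open>\<beta>\<close>, and the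
  two ends \<open>l\<close>, \<open>r\<close> those of \<open>\<beta>'\<close> and \<open>\<beta>''\<close>.
\<close>

locale farey_pair =
  fixes p1 q1 p2 q2 :: int
  assumes q1_pos: "q1 > 0" and q2_pos: "q2 > 0"
    and p1_nonneg: "0 \<le> p1" and p2_le: "p2 \<le> q2"
    and det: "p2 * q1 - p1 * q2 = 1"
begin

definition l :: real where "l = of_int p1 / of_int q1"
definition m :: real where "m = of_int (p1 + p2) / of_int (q1 + q2)"
definition r :: real where "r = of_int p2 / of_int q2"

lemma det_real: "real_of_int p2 * of_int q1 - of_int p1 * of_int q2 = 1"
proof -
  have "real_of_int (p2 * q1 - p1 * q2) = 1" by (simp only: det of_int_1)
  then show ?thesis by simp
qed

lemma m_minus_l: "m - l = 1 / (of_int q1 * of_int (q1 + q2))"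
  using q1_pos q2_pos det_real by (simp add: m_def l_def field_simps)

lemma r_minus_m: "r - m = 1 / (of_int q2 * of_int (q1 + q2))"
  using q1_pos q2_pos det_real by (simp add: m_def r_def field_simps)

lemma order: "0 \<le> l" "l < m" "m < r" "r \<le> 1"
proof -
  show "0 \<le> l" using p1_nonneg q1_pos by (simp add: l_def)
  show "r \<le> 1" using p2_le q2_pos by (simp add: r_def)
  have "0 < m - l" unfolding m_minus_l using q1_pos q2_pos by simp
  then show "l < m" by simp
  have "0 < r - m" unfolding r_minus_m using q1_pos q2_pos by simp
  then show "m < r" by simp
qed

lemma coprime_m: "coprime (p1 + p2) (q1 + q2)"
proof (rule coprimeI)
  fix d assume "d dvd p1 + p2" "d dvd q1 + q2"
  then have "d dvd (p1 + p2) * q1 - p1 * (q1 + q2)" by (intro dvd_diff) auto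
  also have "\<dots> = 1" using det by (simp add: algebra_simps)
  finally show "d dvd 1" .
qed

lemma coprime_l: "coprime p1 q1"
proof (rule coprimeI)
  fix d assume "d dvd p1" "d dvd q1"
  then have "d dvd p2 * q1 - p1 * q2" by (intro dvd_diff) auto
  then show "d dvd 1" by (simp only: det)
qed

lemma coprime_r: "coprime p2 q2"
proof (rule coprimeI)
  fix d assume "d dvd p2" "d dvd q2"
  then have "d dvd p2 * q1 - p1 * q2" by (intro dvd_diff) auto
  then show "d dvd 1" by (simp only: det)
qed

lemma height_m: "height (to_circle m) = nat (q1 + q2)"
  unfolding m_def using q1_pos q2_pos by (intro height_eq coprime_m) simp

lemma height_l: "height (to_circle l) = nat q1"
  unfolding l_def using height_eq coprime_l q1_pos by simp

lemma height_r: "height (to_circle r) = nat q2"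
  unfolding r_def using height_eq coprime_r q2_pos by simp

text \<open>The two strict inequalities say that the integer determinants of \<open>c/d\<close>
  against \<open>l\<close> and against \<open>m\<close> are at least 1. By \<open>det\<close>,
  \<open>d\<close> is their combination with weights \<open>q1 + q2\<close> and \<open>q1\<close>,
  hence at least \<open>2 * q1 + q2\<close>.\<close>

lemma denominator_left:
  assumes "d > 0" "l < of_int c / of_int d" "of_int c / of_int d < m"
  shows "q1 + q2 < d"
proof -
  have "real_of_int (p1 * d) < of_int (c * q1)"
    using assms(1,2) q1_pos by (simp add: l_def field_simps)
  then have 1: "1 \<le> c * q1 - p1 * d" by linarith
  have "real_of_int (c * (q1 + q2)) < of_int ((p1 + p2) * d)"
    using assms(1,3) q1_pos q2_pos by (simp add: m_def field_simps)
  then have 2: "1 \<le> (p1 + p2) * d - c * (q1 + q2)" by linarith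
  have "d = d * (p2 * q1 - p1 * q2)" by (simp only: det mult_1_right)
  also have "\<dots> = (c * q1 - p1 * d) * (q1 + q2) + ((p1 + p2) * d - c * (q1 + q2)) * q1"
    by (simp add: algebra_simps)
  also have "\<dots> \<ge> 1 * (q1 + q2) + 1 * q1"
    using 1 2 q1_pos q2_pos by (intro add_mono mult_right_mono) auto
  finally show ?thesis using q1_pos by simp
qed

text \<open>The same argument on the other side of \<open>m\<close>, with weights
  \<open>q1 + q2\<close> and \<open>q2\<close>.\<close>

lemma denominator_right:
  assumes "d > 0" "m < of_int c / of_int d" "of_int c / of_int d < r"
  shows "q1 + q2 < d"
proof -
  have "real_of_int (c * q2) < of_int (p2 * d)"
    using assms(1,3) q2_pos by (simp add: r_def field_simps)
  then have 1: "1 \<le> p2 * d - c * q2" by linarith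
  have "real_of_int ((p1 + p2) * d) < of_int (c * (q1 + q2))"
    using assms(1,2) q1_pos q2_pos by (simp add: m_def field_simps)
  then have 2: "1 \<le> c * (q1 + q2) - (p1 + p2) * d" by linarith
  have "d = d * (p2 * q1 - p1 * q2)" by (simp only: det mult_1_right)
  also have "\<dots> = (p2 * d - c * q2) * (q1 + q2) + (c * (q1 + q2) - (p1 + p2) * d) * q2"
    by (simp add: algebra_simps)
  also have "\<dots> \<ge> 1 * (q1 + q2) + 1 * q2"
    using 1 2 q1_pos q2_pos by (intro add_mono mult_right_mono) auto
  finally show ?thesis using q2_pos by simp
qed

text \<open>Combines both denominator bounds. It identifies the two neighbours of \<open>m\<close>,
  and later keeps the neighbours of other points of the arc from jumping over
  \<open>m\<close>.\<close>

lemma height_between: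
  assumes "to_circle x \<in> rat_circle" "l < x" "x < r" "x \<noteq> m"
  shows "height (to_circle m) < height (to_circle x)"
proof -
  obtain c d :: int where cd: "d > 0" "coprime c d" "x = of_int c / of_int d"
    using rat_circle_to_circleD[OF assms(1)] by blast
  have "q1 + q2 < d"
    using denominator_left[of d c] denominator_right[of d c] assms cd by (cases "x < m") auto
  then show ?thesis using height_eq[OF cd(1,2)] cd height_m by auto
qed

lemma in_rat_circle: "to_circle l \<in> rat_circle" "to_circle m \<in> rat_circle" "to_circle r \<in> rat_circle"
  unfolding l_def m_def r_def by (rule to_circle_in_rat_circle)+

lemma left_nbr_m: "left_nbr (to_circle m) = to_circle l"
proof -
  let ?F = "farey (height (to_circle m))"
  have 1: "to_circle l \<in> ?F"
    using height_l height_m q2_pos in_rat_circle by (auto simp: farey_def)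
  have 2: "to_circle l \<noteq> to_circle m"
    using to_circle_eq_close[of l m] order by auto
  have 3: "arc_between (to_circle l) (to_circle m) \<inter> ?F = {}"
    using height_between order by (fastforce simp: arc_between_to_circle farey_def)
  show ?thesis
    unfolding left_nbr_def
    by (rule the_equality) (use 1 2 3 in \<open>auto intro: left_gap_unique\<close>)
qed

lemma right_nbr_m: "right_nbr (to_circle m) = to_circle r"
proof -
  let ?F = "farey (height (to_circle m))"
  have 1: "to_circle r \<in> ?F"
    using height_r height_m q1_pos in_rat_circle by (auto simp: farey_def)
  have 2: "to_circle r \<noteq> to_circle m"
    using to_circle_eq_close[of r m] order by auto
  have 3: "arc_between (to_circle m) (to_circle r) \<inter> ?F = {}"
    using height_between order by (fastforce simp: arc_between_to_circle farey_def)
  show ?thesis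
    unfolding right_nbr_def
    by (rule the_equality) (use 1 2 3 in \<open>auto intro: right_gap_unique\<close>)
qed

lemma m_nonzero: "to_circle m \<noteq> 0"
  using to_circle_eq_close[of m 0] order by (auto simp: to_circle_0)

text \<open>
  The slopes cancel because \<open>h(\<beta>) = h(\<beta>') + h(\<beta>'')\<close>, and the constant terms combine to these
  values because the numerators are additive as well.
\<close>

lemma farey_fun_m:
  assumes "c \<notin> {to_circle l, to_circle m, to_circle r}"
  shows "farey_fun (to_circle m) c =
    of_int q1 * indicator (to_circle ` {l<..<m}) c - of_int q2 * indicator (to_circle ` {m<..<r}) c"
proof -
  obtain x where x: "c = to_circle x" "l \<le> x" "x < l + 1" using to_circle_rep by blast
  with assms have "x \<noteq> l" and ne: "x \<noteq> m" "x \<noteq> r" by auto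
  with x have "l < x" by simp
  note ne = this ne
  have mem: "c \<in> to_circle ` {u<..<v} \<longleftrightarrow> u < x \<and> x < v" if "l \<le> u" "v \<le> l + 1" for u v
  proof
    assume "c \<in> to_circle ` {u<..<v}"
    then obtain y where y: "to_circle x = to_circle y" "u < y" "y < v" using x by auto
    have "x = y" by (rule to_circle_eq_close[OF y(1)]) (use x y that ne in linarith)
    with y show "u < x \<and> x < v" by simp
  qed (use x in auto)
  \<comment> \<open>The arc is no longer than a full turn, so \<open>x - m\<close> and
    \<open>x - r\<close> stay in \<open>(-1, 1)\<close>, where the two formulas for
    \<open>psi\<close> apply.\<close>
  have "r - l = 1 / (of_int q1 * of_int q2)"
    using q1_pos q2_pos det_real by (simp add: l_def r_def field_simps)
  also have "\<dots> \<le> 1 / (1 * 1)"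
    using q1_pos q2_pos by (intro divide_left_mono mult_mono) auto
  finally have rl: "r \<le> l + 1" by simp
  have num: "of_int (q1 + q2) * m = of_int q1 * l + of_int q2 * r"
    using q1_pos q2_pos by (simp add: m_def l_def r_def)
  have "farey_fun (to_circle m) c =
      of_int (q1 + q2) * psi (to_circle (x - m)) - of_int q1 * psi (to_circle (x - l))
      - of_int q2 * psi (to_circle (x - r))"
    using m_nonzero q1_pos q2_pos
    by (simp add: farey_fun_def left_nbr_m right_nbr_m height_m height_l height_r x to_circle_diff)
  also have "psi (to_circle (x - l)) = x - l - 1/2"
    by (rule psi_to_circle_pos) (use x ne in auto)
  also have "psi (to_circle (x - m)) = x - m + (if x < m then 1/2 else - 1/2)"
    using psi_to_circle_pos[of "x - m"] psi_to_circle_neg[of "x - m"] x ne order rl by auto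
  also have "psi (to_circle (x - r)) = x - r + (if x < r then 1/2 else - 1/2)"
    using psi_to_circle_pos[of "x - r"] psi_to_circle_neg[of "x - r"] x ne order rl by auto
  finally have val: "farey_fun (to_circle m) c =
      of_int (q1 + q2) * (x - m + (if x < m then 1/2 else - 1/2)) - of_int q1 * (x - l - 1/2)
      - of_int q2 * (x - r + (if x < r then 1/2 else - 1/2))" .
  have "c \<in> to_circle ` {l<..<m} \<longleftrightarrow> x < m" "c \<in> to_circle ` {m<..<r} \<longleftrightarrow> m < x \<and> x < r"
    using mem[of l m] mem[of m r] ne order rl by auto
  then show ?thesis
    unfolding val using num ne order by (auto simp: indicator_def algebra_simps)
qed

lemma AE_farey_fun_m:
  "AE c in haar. farey_fun (to_circle m) c =
    of_int q1 * indicator (to_circle ` {l<..<m}) c - of_int q2 * indicator (to_circle ` {m<..<r}) c"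
proof (rule AE_I')
  have "{to_circle l} \<union> {to_circle m} \<union> {to_circle r} \<in> null_sets haar"
    by (intro null_sets.Un haar_singleton)
  then show "{to_circle l, to_circle m, to_circle r} \<in> null_sets haar"
    by (simp add: insert_commute)
qed (use farey_fun_m in blast)

end

text \<open>For \<open>c = a/q\<close>, the left denominator \<open>u\<close> is the inverse of
  \<open>a\<close> modulo \<open>q\<close> in \<open>(0, q)\<close>. The right fraction is what
  remains of \<open>a/q\<close> once the left numerator and denominator are subtracted.\<close>

lemma farey_pair_exists:
  assumes "c \<in> rat_circle" "c \<noteq> 0"
  shows "\<exists>p1 q1 p2 q2. farey_pair p1 q1 p2 q2 \<and> c = to_circle (farey_pair.m p1 q1 p2 q2)"
proof -
  obtain a q :: int where aq: "0 < a" "a < q" "coprime a q" "c = to_circle (of_int a / of_int q)"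
    using rat_circle_rep[OF assms] by blast
  obtain s t where "a * s + q * t = 1"
    using aq(3) bezout_int[of a q] by (auto simp: mult.commute)
  define u where "u = s mod q"
  \<comment> \<open>This choice compensates for the reduction of \<open>s\<close> modulo
    \<open>q\<close>, so that \<open>a * u - v * q = 1\<close>, which is also the determinant of the
    pair.\<close>
  define v where "v = - t - a * (s div q)"
  have "a * u - v * q = a * (s div q * q + s mod q) + q * t"
    unfolding u_def v_def by (simp only: algebra_simps)
  then have uv: "a * u - v * q = 1" using \<open>a * s + q * t = 1\<close> by simp
  have u0: "0 \<le> u" "u < q" using aq by (auto simp: u_def)
  have "u \<noteq> 0"
  proof
    assume "u = 0"
    then have "q dvd 1" using uv by (metis dvd_triv_right dvd_minus_iff diff_0 mult_zero_right)
    then show False using aq by auto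
  qed
  then have u: "0 < u" using u0 by simp
  have "0 \<le> v"
  proof (rule ccontr)
    assume "\<not> 0 \<le> v"
    then have "v * q \<le> - 1 * q" using aq by (intro mult_right_mono) auto
    moreover have "0 \<le> a * u" using aq u by simp
    ultimately show False using uv aq by linarith
  qed
  \<comment> \<open>This bound puts the right fraction at or below 1; its failure would force
    \<open>q \<le> 1\<close>, against \<open>0 < a < q\<close>.\<close>
  have "a - v \<le> q - u"
  proof (rule ccontr)
    assume "\<not> a - v \<le> q - u"
    then have "(q - u + 1) * q \<le> (a - v) * q" using aq by (intro mult_right_mono) auto
    also have "\<dots> = a * (q - u) + 1" using uv by (simp add: algebra_simps)
    also have "\<dots> \<le> q * (q - u) + 1" using aq u0 by (intro add_mono mult_right_mono) auto
    finally have "q \<le> 1" by (simp add: algebra_simps)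
    then show False using aq by auto
  qed
  have fp: "farey_pair v u (a - v) (q - u)"
    by standard (use u u0 \<open>0 \<le> v\<close> \<open>a - v \<le> q - u\<close> uv in \<open>auto simp: algebra_simps\<close>)
  then show ?thesis
    using aq(4) by (intro exI[of _ v] exI[of _ u] exI[of _ "a - v"] exI[of _ "q - u"])
      (simp add: farey_pair.m_def)
qed

section \<open>Components, atoms and the filtration\<close>

text \<open>Points of \<open>U\<close> have connected neighbourhoods inside \<open>U\<close>, namely
  images of real balls, and by maximality a component contains each of these that it meets.\<close>

lemma open_component_circle:
  fixes U :: "circle set"
  assumes "open U" "J \<in> components U"
  shows "open J"
  unfolding open_circle_def open_contains_ball
proof
  fix x assume x: "x \<in> to_circle -` J"
  with assms(2) have "x \<in> to_circle -` U" using in_components_subset by auto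
  then obtain e where e: "e > 0" "ball x e \<subseteq> to_circle -` U"
    using assms(1) unfolding open_circle_def open_contains_ball by blast
  have "to_circle ` ball x e \<subseteq> J"
  proof (rule components_maximal[OF assms(2)])
    show "connected (to_circle ` ball x e)" by (intro connected_to_circle_image connected_ball)
    show "J \<inter> to_circle ` ball x e \<noteq> {}" using x e(1) by (auto intro!: centre_in_ball[THEN iffD2])
  qed (use e in auto)
  with e(1) show "\<exists>e>0. ball x e \<subseteq> to_circle -` J" by auto
qed

text \<open>The preimages of the components are disjoint open subsets of the real line, and
  surjectivity of \<open>to_circle\<close> keeps distinct components distinct.\<close>

lemma countable_components_circle:
  fixes U :: "circle set"
  assumes "open U"
  shows "countable (components U)"
proof -
  have "countable ((-`) to_circle ` components U)"
  proof (rule countable_disjoint_open_subsets)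
    show "open S" if "S \<in> (-`) to_circle ` components U" for S
      using that open_component_circle[OF assms] by (auto simp: open_circle_def)
    show "pairwise disjnt ((-`) to_circle ` components U)"
      using components_nonoverlap[of _ U] by (fastforce simp: pairwise_def disjnt_def)
  qed
  moreover have "inj_on ((-`) to_circle) (components U)"
    using to_circle_surj by (intro inj_onI) (metis UNIV_eq_I rangeI surj_image_vimage_eq)
  ultimately show ?thesis by (rule countable_image_inj_on)
qed

lemma open_Compl_finite_circle:
  fixes S :: "circle set"
  assumes "finite S"
  shows "open (UNIV - S)"
proof -
  have "closed (\<Union>c\<in>S. {c})" using assms by (intro closed_UN) (auto intro: closed_circle_singleton)
  then show ?thesis by (simp add: closed_def Compl_eq_Diff_UNIV)
qed

text \<open>The generators of \<open>filt\<close> form a countable partition of the circle, so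
  measurable sets are exactly the unions of atoms.\<close>

definition atoms :: "(nat \<Rightarrow> circle) \<Rightarrow> nat \<Rightarrow> circle set set" where
  "atoms \<beta> n = components (UNIV - \<beta> ` {1..n}) \<union> {{\<beta> k} | k. k \<in> {1..n}}"

lemma sets_filt: "sets (filt \<beta> n) = sigma_sets UNIV (atoms \<beta> n)"
  by (simp add: filt_def atoms_def)

lemma space_filt: "space (filt \<beta> n) = UNIV"
  by (simp add: filt_def)

lemma countable_atoms: "countable (atoms \<beta> n)"
  unfolding atoms_def
  by (intro countable_Un countable_components_circle open_Compl_finite_circle)
     (auto intro: countable_finite)

lemma Union_atoms: "\<Union> (atoms \<beta> n) = UNIV"
proof -
  have "\<Union> (atoms \<beta> n) = (UNIV - \<beta> ` {1..n}) \<union> \<Union> {{\<beta> k} | k. k \<in> {1..n}}"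
    unfolding atoms_def Union_Un_distrib by (simp only: Union_components)
  then show ?thesis by blast
qed

text \<open>The atoms cover the circle, so \<open>A\<close> is the union of the atoms inside it, and
  this union is countable.\<close>

lemma in_sets_filt_if_saturated:
  assumes "\<And>G. G \<in> atoms \<beta> n \<Longrightarrow> G \<subseteq> A \<or> G \<inter> A = {}"
  shows "A \<in> sets (filt \<beta> n)"
proof -
  have "A = \<Union> {G \<in> atoms \<beta> n. G \<subseteq> A}"
    using assms Union_atoms[of \<beta> n] by blast
  also have "\<dots> \<in> sets (filt \<beta> n)"
    by (rule sets.countable_Union)
       (auto simp: sets_filt intro: countable_subset[OF _ countable_atoms])
  finally show ?thesis .
qed

text \<open>For fixed \<open>S\<close>, the sets that contain or miss \<open>S\<close> are closed
  under complements and countable unions, so the property passes from the generators to the whole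
  \<sigma>-algebra.\<close>

lemma sets_filt_dichotomy:
  assumes "A \<in> sets (filt \<beta> n)"
    and "\<And>G. G \<in> atoms \<beta> n \<Longrightarrow> S \<subseteq> G \<or> S \<inter> G = {}"
  shows "S \<subseteq> A \<or> S \<inter> A = {}"
  using assms(1) unfolding sets_filt
  by induction (use assms(2) in blast)+

text \<open>On singleton atoms constancy is automatic, so every preimage under \<open>f\<close> is a
  union of atoms.\<close>

lemma borel_measurable_filt_if_constant:
  fixes f :: "circle \<Rightarrow> real"
  assumes "\<And>J x y. J \<in> components (UNIV - \<beta> ` {1..n}) \<Longrightarrow> x \<in> J \<Longrightarrow> y \<in> J \<Longrightarrow> f x = f y"
  shows "f \<in> borel_measurable (filt \<beta> n)"
proof (rule measurableI)
  fix B :: "real set"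
  have "G \<subseteq> f -` B \<or> G \<inter> f -` B = {}" if "G \<in> atoms \<beta> n" for G
  proof -
    have "f x = f y" if "x \<in> G" "y \<in> G" for x y
      using \<open>G \<in> atoms \<beta> n\<close> assms that unfolding atoms_def by blast
    then show ?thesis by (metis disjoint_iff subsetI vimage_eq)
  qed
  then show "f -` B \<inter> space (filt \<beta> n) \<in> sets (filt \<beta> n)"
    by (simp add: space_filt in_sets_filt_if_saturated)
qed simp

lemma subalgebra_filt: "subalgebra haar (filt \<beta> n)"
proof -
  have "atoms \<beta> n \<subseteq> sets borel"
    unfolding atoms_def
    using open_component_circle[OF open_Compl_finite_circle] closed_circle_singleton
    by (blast intro: borel_open borel_closed finite_imageI)
  then have "sigma_sets UNIV (atoms \<beta> n) \<subseteq> sets borel"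
    using sets.sigma_sets_subset[of "atoms \<beta> n" borel] by simp
  then show ?thesis
    by (simp add: subalgebra_def space_filt space_haar sets_filt sets_haar)
qed

text \<open>Adding a point refines the atoms: a new component is connected and avoids the earlier
  points, so it lies in a single old component.\<close>

lemma sets_filt_mono: "sets (filt \<beta> n) \<subseteq> sets (filt \<beta> (n + 1))"
proof -
  have "H \<in> sets (filt \<beta> (n + 1))" if H: "H \<in> atoms \<beta> n" for H
  proof (rule in_sets_filt_if_saturated)
    fix G assume G: "G \<in> atoms \<beta> (n + 1)"
    show "G \<subseteq> H \<or> G \<inter> H = {}"
    proof (cases "G \<in> components (UNIV - \<beta> ` {1..n + 1})")
      case True
      then have conn: "connected G" and sub: "G \<subseteq> UNIV - \<beta> ` {1..n}"
        using in_components_connected in_components_subset by fastforce+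
      show ?thesis
      proof (cases "H \<in> components (UNIV - \<beta> ` {1..n})")
        case True
        then show ?thesis using components_maximal[OF _ conn sub] by blast
      next
        case False
        with H sub show ?thesis by (auto simp: atoms_def)
      qed
    next
      case False
      with G show ?thesis by (auto simp: atoms_def)
    qed
  qed
  then show ?thesis
    unfolding sets_filt[of \<beta> n] using sets.sigma_sets_subset[of "atoms \<beta> n" "filt \<beta> (n + 1)"]
    by (auto simp: space_filt)
qed

section \<open>Order of appearance in an admissible enumeration\<close>

lemma admissible_index:
  assumes "admissible \<beta>" "c \<in> rat_circle"
  obtains k where "k \<ge> 1" "\<beta> k = c"
  using assms unfolding admissible_def bij_betw_def by (metis atLeast_iff imageE)

lemma admissible_inj:
  assumes "admissible \<beta>" "j \<ge> 1" "k \<ge> 1" "\<beta> j = \<beta> k"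
  shows "j = k"
  using assms unfolding admissible_def bij_betw_def by (auto dest: inj_onD)

lemma admissible_in_rat_circle:
  assumes "admissible \<beta>" "k \<ge> 1"
  shows "\<beta> k \<in> rat_circle"
  using assms unfolding admissible_def bij_betw_def by auto

lemma admissible_zero_iff:
  assumes "admissible \<beta>" "k \<ge> 1"
  shows "\<beta> k = 0 \<longleftrightarrow> k = 1"
  using assms admissible_inj[OF assms(1), of k 1] unfolding admissible_def by auto

context farey_pair
begin

text \<open>
  The right neighbour of a point \<open>\<gamma>\<close> in the open arc from \<open>\<beta>'\<close> to \<open>\<beta>\<close> does not lie beyond \<open>\<beta>\<close>,
  since \<open>h(\<gamma>) > h(\<beta>)\<close>. It precedes \<open>\<gamma>\<close> in the enumeration, so following right neighbours leads
  from \<open>\<gamma>\<close> to \<open>\<beta>\<close> through ever smaller indices.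
\<close>

lemma index_left_arc:
  assumes adm: "admissible \<beta>" and n: "n \<ge> 1" "\<beta> n = to_circle m"
  shows "k \<ge> 1 \<Longrightarrow> \<beta> k = to_circle x \<Longrightarrow> l < x \<Longrightarrow> x < m \<Longrightarrow> n < k"
proof (induction k arbitrary: x rule: less_induct)
  case (less k)
  have rat: "to_circle x \<in> rat_circle"
    using admissible_in_rat_circle[OF adm less.prems(1)] less.prems by simp
  have nz: "to_circle x \<noteq> 0"
    using to_circle_eq_close[of x 0] less.prems order by (auto simp: to_circle_0)
  have k2: "k \<ge> 2"
    using nz less.prems admissible_zero_iff[OF adm less.prems(1)] by auto
  obtain a1 b1 a2 b2 where fp: "farey_pair a1 b1 a2 b2"
    and xm: "to_circle x = to_circle (farey_pair.m a1 b1 a2 b2)"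
    using farey_pair_exists[OF rat nz] by blast
  interpret N: farey_pair a1 b1 a2 b2 by (rule fp)
  have x: "x = N.m"
    by (rule to_circle_eq_close[OF xm]) (use less.prems order N.order in linarith)
  have "height (to_circle m) < height (to_circle x)"
    using height_between[of x] rat less.prems order by auto
  then have le: "N.r \<le> m"
    using N.height_between[of m] in_rat_circle less.prems N.order x by fastforce
  obtain j where j: "j \<ge> 1" "\<beta> j = to_circle N.r"
    using admissible_index[OF adm N.in_rat_circle(3)] by blast
  have "\<beta> j = right_nbr (\<beta> k)"
    using N.right_nbr_m j less.prems x by simp
  then have "j < k" using adm k2 j unfolding admissible_def by blast
  show ?case
  proof (cases "N.r = m")
    case True
    then have "j = n" using admissible_inj[OF adm] j n by auto
    with \<open>j < k\<close> show ?thesis by simp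
  next
    case False
    then have "n < j"
      using less.IH[OF \<open>j < k\<close> j] le N.order x less.prems by auto
    with \<open>j < k\<close> show ?thesis by simp
  qed
qed

text \<open>Mirror image of \<open>index_left_arc\<close>: here left neighbours lead down to
  \<open>m\<close> through ever smaller indices.\<close>

lemma index_right_arc:
  assumes adm: "admissible \<beta>" and n: "n \<ge> 1" "\<beta> n = to_circle m"
  shows "k \<ge> 1 \<Longrightarrow> \<beta> k = to_circle x \<Longrightarrow> m < x \<Longrightarrow> x < r \<Longrightarrow> n < k"
proof (induction k arbitrary: x rule: less_induct)
  case (less k)
  have rat: "to_circle x \<in> rat_circle"
    using admissible_in_rat_circle[OF adm less.prems(1)] less.prems by simp
  have nz: "to_circle x \<noteq> 0"
    using to_circle_eq_close[of x 0] less.prems order by (auto simp: to_circle_0)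
  have k2: "k \<ge> 2"
    using nz less.prems admissible_zero_iff[OF adm less.prems(1)] by auto
  obtain a1 b1 a2 b2 where fp: "farey_pair a1 b1 a2 b2"
    and xm: "to_circle x = to_circle (farey_pair.m a1 b1 a2 b2)"
    using farey_pair_exists[OF rat nz] by blast
  interpret N: farey_pair a1 b1 a2 b2 by (rule fp)
  have x: "x = N.m"
    by (rule to_circle_eq_close[OF xm]) (use less.prems order N.order in linarith)
  have "height (to_circle m) < height (to_circle x)"
    using height_between[of x] rat less.prems order by auto
  \<comment> \<open>If \<open>N.l < m\<close>, then \<open>m\<close> lies strictly between
    \<open>N.l\<close> and \<open>N.m\<close>, and \<open>N.height_between\<close> would make its
    height exceed that of \<open>x\<close>.\<close>
  then have le: "m \<le> N.l"
    using N.height_between[of m] in_rat_circle less.prems N.order x by fastforce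
  obtain j where j: "j \<ge> 1" "\<beta> j = to_circle N.l"
    using admissible_index[OF adm N.in_rat_circle(1)] by blast
  have "\<beta> j = left_nbr (\<beta> k)"
    using N.left_nbr_m j less.prems x by simp
  then have "j < k" using adm k2 j unfolding admissible_def by blast
  show ?case
  proof (cases "N.l = m")
    case True
    then have "j = n" using admissible_inj[OF adm] j n by auto
    with \<open>j < k\<close> show ?thesis by simp
  next
    case False
    then have "n < j"
      using less.IH[OF \<open>j < k\<close> j] le N.order x less.prems by auto
    with \<open>j < k\<close> show ?thesis by simp
  qed
qed

lemma nbr_indices:
  assumes adm: "admissible \<beta>" and n: "n \<ge> 1" "\<beta> n = to_circle m"
  shows "to_circle l \<in> \<beta> ` {1..<n}" "to_circle r \<in> \<beta> ` {1..<n}"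
proof -
  have n2: "n \<ge> 2" using m_nonzero n admissible_zero_iff[OF adm n(1)] by auto
  obtain j where j: "j \<ge> 1" "\<beta> j = to_circle l"
    using admissible_index[OF adm in_rat_circle(1)] by blast
  then have "\<beta> j = left_nbr (\<beta> n)" using left_nbr_m n by simp
  then have "j < n" using adm n2 j unfolding admissible_def by blast
  with j show "to_circle l \<in> \<beta> ` {1..<n}" by force
  obtain k where k: "k \<ge> 1" "\<beta> k = to_circle r"
    using admissible_index[OF adm in_rat_circle(3)] by blast
  then have "\<beta> k = right_nbr (\<beta> n)" using right_nbr_m n by simp
  then have "k < n" using adm n2 k unfolding admissible_def by blast
  with k show "to_circle r \<in> \<beta> ` {1..<n}" by force
qed

section \<open>Measurability and integrals of a single function\<close>

text \<open>All three jump points are among the first \<open>n\<close> points, so a component lies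
  within one piece of the step function.\<close>

lemma farey_fun_m_measurable:
  assumes adm: "admissible \<beta>" and n: "n \<ge> 1" "\<beta> n = to_circle m"
  shows "farey_fun (to_circle m) \<in> borel_measurable (filt \<beta> n)"
proof (rule borel_measurable_filt_if_constant)
  fix J x y assume J: "J \<in> components (UNIV - \<beta> ` {1..n})" and xy: "x \<in> J" "y \<in> J"
  have "connected J" using in_components_connected J by blast
  have "J \<subseteq> UNIV - \<beta> ` {1..n}" using in_components_subset J by blast
  moreover have "to_circle l \<in> \<beta> ` {1..n}" "to_circle r \<in> \<beta> ` {1..n}" "to_circle m \<in> \<beta> ` {1..n}"
    using nbr_indices[OF adm n] n by (auto simp flip: n(2))
  ultimately have J': "to_circle l \<notin> J" "to_circle r \<notin> J" "to_circle m \<notin> J" by blast+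
  have "J \<subseteq> to_circle ` {l<..<m} \<or> J \<inter> to_circle ` {l<..<m} = {}"
    by (rule connected_arc_dichotomy) (use order J' \<open>connected J\<close> in auto)
  moreover have "J \<subseteq> to_circle ` {m<..<r} \<or> J \<inter> to_circle ` {m<..<r} = {}"
    by (rule connected_arc_dichotomy) (use order J' \<open>connected J\<close> in auto)
  moreover have "x \<notin> {to_circle l, to_circle m, to_circle r}"
    "y \<notin> {to_circle l, to_circle m, to_circle r}"
    using xy J' by auto
  ultimately show "farey_fun (to_circle m) x = farey_fun (to_circle m) y"
    using xy by (subst (1 2) farey_fun_m) (auto simp: indicator_def)
qed

text \<open>None of the first \<open>n\<close> points lies in the open arc: \<open>m\<close> has
  index \<open>n + 1\<close>, and the other rational points of the arc come later still. Being
  connected, the arc therefore lies in one component.\<close>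

lemma sets_filt_arc_dichotomy:
  assumes adm: "admissible \<beta>" and n: "\<beta> (n + 1) = to_circle m" and A: "A \<in> sets (filt \<beta> n)"
  shows "to_circle ` {l<..<r} \<subseteq> A \<or> to_circle ` {l<..<r} \<inter> A = {}"
proof (rule sets_filt_dichotomy[OF A])
  let ?S = "to_circle ` {l<..<r}"
  have late: "\<beta> k \<notin> ?S" if "k \<in> {1..n}" for k
  proof
    from that have k: "1 \<le> k" "k \<le> n" by auto
    assume "\<beta> k \<in> ?S"
    then obtain x where x: "\<beta> k = to_circle x" "l < x" "x < r" by auto
    have "x \<noteq> m" using admissible_inj[OF adm, of k "n + 1"] n x k by auto
    then show False
      using index_left_arc[OF adm _ n, of k x] index_right_arc[OF adm _ n, of k x] x k
      by (cases "x < m") auto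
  qed
  have conn: "connected ?S" by (intro connected_to_circle_image) simp
  have sub: "?S \<subseteq> UNIV - \<beta> ` {1..n}" using late by blast
  fix G assume "G \<in> atoms \<beta> n"
  then consider "G \<in> components (UNIV - \<beta> ` {1..n})" | k where "k \<in> {1..n}" "G = {\<beta> k}"
    unfolding atoms_def by blast
  then show "?S \<subseteq> G \<or> ?S \<inter> G = {}"
  proof cases
    case 1
    then show ?thesis using components_maximal[OF _ conn sub] by blast
  next
    case 2
    then show ?thesis using sub by blast
  qed
qed

text \<open>Measurability is a hypothesis because it is obtained from the filtration; the rest
  follows from almost everywhere equality with a step function.\<close>

lemma integrable_farey_fun_m:
  assumes "farey_fun (to_circle m) \<in> borel_measurable haar"
  shows "integrable haar (farey_fun (to_circle m))"
proof -
  interpret prob_space haar by (rule prob_space_haar)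
  have "integrable haar (\<lambda>c. of_int q1 * indicator (to_circle ` {l<..<m}) c
      - of_int q2 * indicator (to_circle ` {m<..<r}) c :: real)"
    using arc_sets by (intro Bochner_Integration.integrable_diff integrable_mult_right)
      (auto simp: less_top[symmetric])
  then show ?thesis
    using integrable_cong_AE[OF _ _ AE_farey_fun_m] assms by auto
qed

lemma set_integral_farey_fun_m:
  assumes adm: "admissible \<beta>" and n: "\<beta> (n + 1) = to_circle m" and A: "A \<in> sets (filt \<beta> n)"
  shows "(LINT c:A|haar. farey_fun (to_circle m) c) = 0"
proof -
  interpret prob_space haar by (rule prob_space_haar)
  let ?L = "to_circle ` {l<..<m}" and ?R = "to_circle ` {m<..<r}"
  have A': "A \<in> sets haar" using A subalgebra_filt by (auto simp: subalgebra_def)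
  have meas: "farey_fun (to_circle m) \<in> borel_measurable haar"
    using farey_fun_m_measurable[OF adm _ n] measurable_from_subalg[OF subalgebra_filt] by auto
  have sets: "?L \<in> sets haar" "?R \<in> sets haar" "A \<inter> ?L \<in> sets haar" "A \<inter> ?R \<in> sets haar"
    using arc_sets A' by auto
  have "(LINT c:A|haar. farey_fun (to_circle m) c) =
      (LINT c|haar. of_int q1 * indicator (A \<inter> ?L) c - of_int q2 * indicator (A \<inter> ?R) c)"
    unfolding set_lebesgue_integral_def
  proof (rule integral_cong_AE)
    show "AE c in haar. indicat_real A c *\<^sub>R farey_fun (to_circle m) c =
        of_int q1 * indicator (A \<inter> ?L) c - of_int q2 * indicator (A \<inter> ?R) c"
      using AE_farey_fun_m by eventually_elim (auto simp: indicator_def)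
  qed (use meas A' sets in measurable)
  also have "\<dots> = of_int q1 * measure haar (A \<inter> ?L) - of_int q2 * measure haar (A \<inter> ?R)"
    using sets by (subst Bochner_Integration.integral_diff) (auto simp: less_top[symmetric] space_haar)
  also have "\<dots> = 0"
    using sets_filt_arc_dichotomy[OF adm n A]
  proof
    assume sub: "to_circle ` {l<..<r} \<subseteq> A"
    have "A \<inter> ?L = ?L" "A \<inter> ?R = ?R" using sub order by force+
    then show ?thesis
      \<comment> \<open>Both products, of height and arc length, equal
        \<open>1 / (q1 + q2)\<close>.\<close>
      using q1_pos q2_pos order by (simp add: measure_haar_arc m_minus_l r_minus_m)
  next
    assume disj: "to_circle ` {l<..<r} \<inter> A = {}"
    have "A \<inter> ?L = {}" "A \<inter> ?R = {}" using disj order by (fastforce simp: disjoint_iff)+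
    then show ?thesis by simp
  qed
  finally show ?thesis .
qed

end

section \<open>The martingale difference property along the enumeration\<close>

text \<open>Carries the results of the locale over to the enumeration: only index 1 holds the point
  0, so every later point is a mediant.\<close>

lemma admissible_farey_pair:
  assumes "admissible \<beta>" "n \<ge> 2"
  shows "\<exists>p1 q1 p2 q2. farey_pair p1 q1 p2 q2 \<and> \<beta> n = to_circle (farey_pair.m p1 q1 p2 q2)"
proof (rule farey_pair_exists)
  show "\<beta> n \<in> rat_circle" using admissible_in_rat_circle assms by simp
  show "\<beta> n \<noteq> 0" using admissible_zero_iff[OF assms(1), of n] assms(2) by simp
qed

lemma farey_fun_measurable:
  assumes "admissible \<beta>" "n \<ge> 1"
  shows "farey_fun (\<beta> n) \<in> borel_measurable (filt \<beta> n)"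
proof (cases "n = 1")
  case True
  then have "\<beta> n = 0" using assms admissible_zero_iff by blast
  then have "farey_fun (\<beta> n) = (\<lambda>_. 1)" by (simp add: farey_fun_def fun_eq_iff)
  then show ?thesis by simp
next
  case False
  with assms(2) have "n \<ge> 2" by simp
  from admissible_farey_pair[OF assms(1) this] farey_pair.farey_fun_m_measurable[OF _ assms]
  show ?thesis by fastforce
qed

lemma integrable_farey_fun:
  assumes "admissible \<beta>" "n \<ge> 1"
  shows "integrable haar (farey_fun (\<beta> n))"
proof (cases "n = 1")
  case True
  interpret prob_space haar by (rule prob_space_haar)
  from True have "\<beta> n = 0" using assms admissible_zero_iff by blast
  then have "farey_fun (\<beta> n) = (\<lambda>_. 1)" by (simp add: farey_fun_def fun_eq_iff)
  then show ?thesis by simp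
next
  case False
  with assms(2) have "n \<ge> 2" by simp
  moreover have "farey_fun (\<beta> n) \<in> borel_measurable haar"
    using measurable_from_subalg[OF subalgebra_filt farey_fun_measurable[OF assms]] .
  ultimately show ?thesis
    using admissible_farey_pair[OF assms(1)] farey_pair.integrable_farey_fun_m by metis
qed

lemma set_integral_farey_fun:
  assumes "admissible \<beta>" "n \<ge> 1" "A \<in> sets (filt \<beta> n)"
  shows "(LINT x:A|haar. farey_fun (\<beta> (n + 1)) x) = 0"
proof -
  obtain p1 q1 p2 q2 where "farey_pair p1 q1 p2 q2"
    and eq: "\<beta> (n + 1) = to_circle (farey_pair.m p1 q1 p2 q2)"
    using admissible_farey_pair[OF assms(1), of "n + 1"] assms(2) by auto
  then show ?thesis
    using farey_pair.set_integral_farey_fun_m[OF _ assms(1) eq assms(3)] eq by simp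
qed

text \<open>Conditional expectation is characterized by integrals over all sets of
  \<open>filt \<beta> n\<close>, which is why the vanishing was proved for these and not only for
  components.\<close>

lemma cond_exp_farey_fun:
  assumes "admissible \<beta>" "n \<ge> 1"
  shows "AE x in haar. real_cond_exp haar (filt \<beta> n) (farey_fun (\<beta> (n + 1))) x = 0"
proof -
  interpret prob_space haar by (rule prob_space_haar)
  interpret finite_measure_subalgebra haar "filt \<beta> n"
    by standard (rule subalgebra_filt)
  show ?thesis
  proof (rule real_cond_exp_charact)
    show "(LINT x:A|haar. farey_fun (\<beta> (n + 1)) x) = (LINT x:A|haar. 0)"
      if "A \<in> sets (filt \<beta> n)" for A
      using set_integral_farey_fun[OF assms that] by (simp add: set_lebesgue_integral_def)
  qed (use assms in \<open>auto intro: integrable_farey_fun\<close>)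
qed

theorem theorem7:
  fixes \<beta> :: "nat \<Rightarrow> circle"
  assumes "admissible \<beta>"
  shows "(\<forall>n\<ge>1. subalgebra haar (filt \<beta> n)) \<and>
         (\<forall>n\<ge>1. integrable haar (farey_fun (\<beta> n))) \<and>
         (\<forall>n\<ge>1. farey_fun (\<beta> n) \<in> borel_measurable (filt \<beta> n)) \<and>
         (\<forall>n\<ge>1. sets (filt \<beta> n) \<subseteq> sets (filt \<beta> (n + 1))) \<and>
         (\<forall>n\<ge>1. AE x in haar. real_cond_exp haar (filt \<beta> n) (farey_fun (\<beta> (n + 1))) x = 0) \<and>
         (\<forall>n\<ge>1. \<forall>J \<in> components (UNIV - \<beta> ` {1..n}).
            (LINT x:J|haar. farey_fun (\<beta> (n + 1)) x) = 0)"
proof (intro conjI allI impI ballI)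
  fix n :: nat and J assume n: "n \<ge> 1" and J: "J \<in> components (UNIV - \<beta> ` {1..n})"
  have "J \<in> sets (filt \<beta> n)" using J by (auto simp: sets_filt atoms_def)
  then show "(LINT x:J|haar. farey_fun (\<beta> (n + 1)) x) = 0"
    by (rule set_integral_farey_fun[OF assms n])
qed (use assms subalgebra_filt integrable_farey_fun farey_fun_measurable sets_filt_mono
      cond_exp_farey_fun in blast)+

end
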